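(* There exists a universal constant $C>0$ such that for every $n\in\mathbb{N}$, for all numbers of inputs and outputs, and for every bipartite quantum probability distribution $P$ obtained with Hilbert spaces $H_1,H_2$ of local dimension $n$, one has $$\nu(P)\le C\,n.$$
   Context: Fix $N$ (number of inputs per site) and $K$ (number of outputs per site). Consider families $P=(P(a,b|x,y))$, $x,y\in\{1,\dots,N\}$, $a,b\in\{1,\dots,K\}$. $P$ is classical ($P\in\mathcal{L}$) if $P(a,b|x,y)=\int_\Omega P_\omega(a|x)Q_\omega(b|y)\,d\mathbb{P}(\omega)$ for all $x,y,a,b$, where $(\Omega,\mathbb{P})$ is a probability space, $P_\omega(a|x)\ge0$, $\sum_aP_\omega(a|x)=1$ for all $x,\omega$, and analogously for $Q_\omega(b|y)$. $P$ is quantum, with Hilbert spaces $H_1,H_2$, if $P(a,b|x,y)=\mathrm{tr}\big((E_x^a\otimes F_y^b)\rho\big)$ for all $x,y,a,b$, where $\rho$ is a density operator on $H_1\otimes H_2$, $E_x^a\in B(H_1)$ and $F_y^b\in B(H_2)$ are positive semidefinite operators, $\sum_aE_x^a=\mathbb{1}$ for every $x$ and $\sum_bF_y^b=\mathbb{1}$ for every $y$. For a real family $M=(M_{x,y}^{a,b})$ put $\langle M,P\rangle=\sum_{x,y,a,b}M_{x,y}^{a,b}P(a,b|x,y)$, and define $$\nu(P)=\sup\{\langle M,P\rangle:\ |\langle M,P'\rangle|\le1\ \text{for every }P'\in\mathcal{L}\},$$ where $\mathcal{L}$ is taken with the same numbers of inputs and outputs as $P$. *)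

theory Defs
  imports
    "HOL-Probability.Probability"
    "Jordan_Normal_Form.Schur_Decomposition"
begin

section \<open>Classical families\<close>

text \<open>
  A family $P(a,b|x,y)$ is a function applied as \<open>P a b x y\<close>; only its values at
  \<open>x, y \<in> {1..N}\<close> and \<open>a, b \<in> {1..K}\<close> are ever used.
\<close>

type_synonym family = "nat \<Rightarrow> nat \<Rightarrow> nat \<Rightarrow> nat \<Rightarrow> real"

definition random_response ::
    "'w measure \<Rightarrow> nat \<Rightarrow> nat \<Rightarrow> (nat \<Rightarrow> nat \<Rightarrow> 'w \<Rightarrow> real) \<Rightarrow> bool" where
  "random_response \<Omega> N K p \<longleftrightarrow>
     (\<forall>x\<in>{1..N}.
        (\<forall>a\<in>{1..K}. p a x \<in> borel_measurable \<Omega> \<and> (\<forall>\<omega>\<in>space \<Omega>. 0 \<le> p a x \<omega>)) \<and>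
        (\<forall>\<omega>\<in>space \<Omega>. (\<Sum>a=1..K. p a x \<omega>) = 1))"

definition classical_via :: "'w measure \<Rightarrow> nat \<Rightarrow> nat \<Rightarrow> family \<Rightarrow> bool" where
  "classical_via \<Omega> N K P \<longleftrightarrow>
     prob_space \<Omega> \<and>
     (\<exists>p q. random_response \<Omega> N K p \<and> random_response \<Omega> N K q \<and>
        (\<forall>x\<in>{1..N}. \<forall>y\<in>{1..N}. \<forall>a\<in>{1..K}. \<forall>b\<in>{1..K}.
           P a b x y = (LINT \<omega>|\<Omega>. p a x \<omega> * q b y \<omega>)))"

text \<open>
  HOL cannot quantify existentially over the type of the sample space, so the sample points
  are taken to be pairs of response tables. This loses nothing: by \<open>classical_of_any_space\<close>
  below, a representation over a probability space of any type can be transported to one of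
  this type.
\<close>

definition classical :: "nat \<Rightarrow> nat \<Rightarrow> family set" where
  "classical N K =
     {P. \<exists>\<Omega> :: ((nat \<Rightarrow> nat \<Rightarrow> real) \<times> (nat \<Rightarrow> nat \<Rightarrow> real)) measure. classical_via \<Omega> N K P}"

lemma classical_of_any_space:
  fixes \<Omega> :: "'w measure"
  assumes "classical_via \<Omega> N K P"
  shows "P \<in> classical N K"
proof -
  from assms obtain p q where prob: "prob_space \<Omega>"
    and p: "random_response \<Omega> N K p" and q: "random_response \<Omega> N K q"
    and P: "\<And>x y a b. x \<in> {1..N} \<Longrightarrow> y \<in> {1..N} \<Longrightarrow> a \<in> {1..K} \<Longrightarrow> b \<in> {1..K} \<Longrightarrow>
              P a b x y = (LINT \<omega>|\<Omega>. p a x \<omega> * q b y \<omega>)"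
    unfolding classical_via_def by blast
  define T where "T = (\<lambda>\<omega>. (\<lambda>a x. p a x \<omega>, \<lambda>b y. q b y \<omega>))"
  define S where "S = sigma (T ` space \<Omega>) {A. A \<subseteq> T ` space \<Omega> \<and> T -` A \<inter> space \<Omega> \<in> sets \<Omega>}"
  define \<Omega>' where "\<Omega>' = distr \<Omega> S T"
  define p' where "p' = (\<lambda>a x (\<omega> :: (nat \<Rightarrow> nat \<Rightarrow> real) \<times> (nat \<Rightarrow> nat \<Rightarrow> real)). fst \<omega> a x)"
  define q' where "q' = (\<lambda>b y (\<omega> :: (nat \<Rightarrow> nat \<Rightarrow> real) \<times> (nat \<Rightarrow> nat \<Rightarrow> real)). snd \<omega> b y)"
  have T: "T \<in> measurable \<Omega> S"
    unfolding S_def by (rule measurable_measure_of) auto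
  have space: "space \<Omega>' = T ` space \<Omega>"
    unfolding \<Omega>'_def S_def by (simp add: space_measure_of_conv)
  have final: "f \<in> borel_measurable \<Omega>'"
    if "(\<lambda>\<omega>. f (T \<omega>)) \<in> borel_measurable \<Omega>" for f :: "_ \<Rightarrow> real"
  proof (rule measurableI)
    fix B :: "real set" assume "B \<in> sets borel"
    then have "(\<lambda>\<omega>. f (T \<omega>)) -` B \<inter> space \<Omega> \<in> sets \<Omega>"
      using that by (rule measurable_sets[rotated])
    moreover have "T -` (f -` B \<inter> T ` space \<Omega>) \<inter> space \<Omega> = (\<lambda>\<omega>. f (T \<omega>)) -` B \<inter> space \<Omega>"
      by auto
    ultimately have "f -` B \<inter> T ` space \<Omega> \<in> sets S"
      unfolding S_def by (subst sets_measure_of) (auto intro!: sigma_sets.Basic)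
    then show "f -` B \<inter> space \<Omega>' \<in> sets \<Omega>'"
      by (simp add: space) (simp add: \<Omega>'_def)
  qed auto
  have p'T: "p' a x (T \<omega>) = p a x \<omega>" and q'T: "q' b y (T \<omega>) = q b y \<omega>" for a b x y \<omega>
    by (simp_all add: p'_def q'_def T_def)
  have p': "random_response \<Omega>' N K p'"
    using p unfolding random_response_def by (auto simp: space p'T intro!: final)
  have q': "random_response \<Omega>' N K q'"
    using q unfolding random_response_def by (auto simp: space q'T intro!: final)
  have "P a b x y = (LINT \<omega>|\<Omega>'. p' a x \<omega> * q' b y \<omega>)"
    if "x \<in> {1..N}" "y \<in> {1..N}" "a \<in> {1..K}" "b \<in> {1..K}" for x y a b
  proof -
    have "p' a x \<in> borel_measurable \<Omega>'" "q' b y \<in> borel_measurable \<Omega>'"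
      using p' q' that unfolding random_response_def by auto
    then have m: "(\<lambda>\<omega>. p' a x \<omega> * q' b y \<omega>) \<in> borel_measurable S"
      by (simp add: \<Omega>'_def)
    show ?thesis
      using integral_distr[OF T m] P[OF that] by (simp add: \<Omega>'_def p'T q'T)
  qed
  moreover have "prob_space \<Omega>'"
    unfolding \<Omega>'_def by (rule prob_space.prob_space_distr[OF prob T])
  ultimately show ?thesis
    using p' q' unfolding classical_def classical_via_def by blast
qed

section \<open>Quantum families\<close>

text \<open>
  A Hilbert space of dimension \<open>n\<close> is modelled by complex \<open>n\<close>-space with its standard inner
  product, so operators are complex matrices and the tensor product of operators is the
  Kronecker product.
\<close>

definition mat_trace :: "complex mat \<Rightarrow> complex" where
  "mat_trace A = (\<Sum>i<dim_row A. A $$ (i, i))"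

definition kronecker :: "complex mat \<Rightarrow> complex mat \<Rightarrow> complex mat" where
  "kronecker A B =
     mat (dim_row A * dim_row B) (dim_col A * dim_col B)
       (\<lambda>(i, j). A $$ (i div dim_row B, j div dim_col B) * B $$ (i mod dim_row B, j mod dim_col B))"

definition psd :: "nat \<Rightarrow> complex mat \<Rightarrow> bool" where
  "psd n A \<longleftrightarrow>
     A \<in> carrier_mat n n \<and> mat_adjoint A = A \<and>
     (\<forall>v\<in>carrier_vec n. 0 \<le> Re ((A *\<^sub>v v) \<bullet>c v))"

definition density_operator :: "nat \<Rightarrow> complex mat \<Rightarrow> bool" where
  "density_operator n \<rho> \<longleftrightarrow> psd n \<rho> \<and> mat_trace \<rho> = 1"

definition povm :: "nat \<Rightarrow> nat \<Rightarrow> (nat \<Rightarrow> complex mat) \<Rightarrow> bool" where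
  "povm n K E \<longleftrightarrow>
     (\<forall>a\<in>{1..K}. psd n (E a)) \<and>
     finsum (module_mat TYPE(complex) n n) E {1..K} = 1\<^sub>m n"

definition quantum :: "nat \<Rightarrow> nat \<Rightarrow> nat \<Rightarrow> nat \<Rightarrow> family set" where
  "quantum n1 n2 N K =
     {P. \<exists>\<rho> E F. density_operator (n1 * n2) \<rho> \<and>
           (\<forall>x\<in>{1..N}. povm n1 K (E x)) \<and> (\<forall>y\<in>{1..N}. povm n2 K (F y)) \<and>
           (\<forall>x\<in>{1..N}. \<forall>y\<in>{1..N}. \<forall>a\<in>{1..K}. \<forall>b\<in>{1..K}.
              complex_of_real (P a b x y) = mat_trace (kronecker (E x a) (F y b) * \<rho>))}"

section \<open>The largest Bell violation\<close>

text \<open>Bell functionals $M_{x,y}^{a,b}$ are applied as \<open>M x y a b\<close>.\<close>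

definition bell_pairing ::
    "nat \<Rightarrow> nat \<Rightarrow> (nat \<Rightarrow> nat \<Rightarrow> nat \<Rightarrow> nat \<Rightarrow> real) \<Rightarrow> family \<Rightarrow> real" where
  "bell_pairing N K M P =
     (\<Sum>x=1..N. \<Sum>y=1..N. \<Sum>a=1..K. \<Sum>b=1..K. M x y a b * P a b x y)"

text \<open>The supremum is taken in the extended reals, so that it is meaningful when unbounded.\<close>

definition nu :: "nat \<Rightarrow> nat \<Rightarrow> family \<Rightarrow> ereal" where
  "nu N K P =
     (SUP M \<in> {M. \<forall>P'\<in>classical N K. \<bar>bell_pairing N K M P'\<bar> \<le> 1}.
        ereal (bell_pairing N K M P))"

end

theory Submission
  imports Defs
begin

text \<open>
  Measuring the second half of \<open>\<rho>\<close> steers the first half into positive matrices \<open>G y b\<close> with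
  \<open>\<Sum>b. G y b = \<sigma>\<close>, the reduced state, and \<open>P(a,b|x,y) = tr (E x a * G y b)\<close>. For a vector \<open>v\<close>
  the product \<open>\<langle>v, E x a v\<rangle> * \<langle>v, G y b v\<rangle>\<close> is a classical family scaled by \<open>\<parallel>v\<parallel>\<^sup>2 * \<langle>v, \<sigma> v\<rangle>\<close>.
  Polarizing with \<open>v = e\<^sub>i + w e\<^sub>j\<close>, \<open>w\<^sup>4 = 1\<close>, turns each pair of terms \<open>(i, j)\<close> of the trace
  into such products of total weight at most \<open>6 (\<sigma>\<^sub>i\<^sub>i + \<sigma>\<^sub>j\<^sub>j)\<close>; half the sum over all pairs is \<open>6 n\<close>.
\<close>

section \<open>Positive semidefinite forms\<close>

definition qform :: "'a set \<Rightarrow> ('a \<Rightarrow> 'a \<Rightarrow> complex) \<Rightarrow> ('a \<Rightarrow> complex) \<Rightarrow> complex" where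
  "qform S f v = (\<Sum>k\<in>S. \<Sum>l\<in>S. cnj (v k) * f k l * v l)"

text \<open>In the order on the complex numbers, \<open>0 \<le> z\<close> also says that
  \<open>z\<close> is real, so Hermitian symmetry is built in. An arbitrary index set
  \<open>S\<close> lets an induction remove one index at a time.\<close>

definition psd_on :: "'a set \<Rightarrow> ('a \<Rightarrow> 'a \<Rightarrow> complex) \<Rightarrow> bool" where
  "psd_on S f \<longleftrightarrow> (\<forall>v. 0 \<le> qform S f v)"

definition two_point :: "'a \<Rightarrow> 'a \<Rightarrow> complex \<Rightarrow> 'a \<Rightarrow> complex" where
  "two_point i j w k = of_bool (k = i) + w * of_bool (k = j)"

lemma psd_onD: "psd_on S f \<Longrightarrow> 0 \<le> qform S f v"
  by (simp add: psd_on_def)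

lemma qform_cong:
  assumes "\<And>k l. k \<in> S \<Longrightarrow> l \<in> S \<Longrightarrow> f k l = g k l"
  shows "qform S f v = qform S g v"
  unfolding qform_def by (intro sum.cong refl) (simp add: assms)

lemma qform_sum:
  "(\<Sum>c\<in>T. qform S (f c) v) = qform S (\<lambda>k l. \<Sum>c\<in>T. f c k l) v"
  unfolding qform_def
  by (subst sum.swap, intro sum.cong refl, subst sum.swap)
     (simp add: sum_distrib_left sum_distrib_right)

text \<open>The formula also covers \<open>i = j\<close>, where the vector is \<open>(1 + w)\<close>
  times a basis vector, so later sums over all pairs need no case split.\<close>

lemma qform_two_point:
  assumes "finite S" "i \<in> S" "j \<in> S"
  shows "qform S f (two_point i j w) = f i i + w * f i j + cnj w * f j i + w * cnj w * f j j"
proof -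
  have inner: "(\<Sum>l\<in>S. cnj (two_point i j w k) * f k l * two_point i j w l)
      = cnj (two_point i j w k) * (f k i + w * f k j)" for k
    using assms
    by (simp add: two_point_def ring_distribs of_bool_def if_distrib[of "\<lambda>c. _ * c"] sum.distrib
             cong: if_cong)
  have "qform S f (two_point i j w)
      = (\<Sum>k\<in>S. of_bool (k = i) * (f k i + w * f k j) + of_bool (k = j) * (cnj w * (f k i + w * f k j)))"
    unfolding qform_def inner by (intro sum.cong refl) (simp add: two_point_def algebra_simps)
  also have "\<dots> = (f i i + w * f i j) + cnj w * (f j i + w * f j j)"
    using assms by (simp add: sum.distrib of_bool_def if_distrib[of "\<lambda>c. c * _"] cong: if_cong)
  finally show ?thesis by (simp add: algebra_simps)
qed

lemma psd_on_diag:
  assumes "finite S" "psd_on S f" "i \<in> S"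
  shows "0 \<le> f i i"
  using psd_onD[OF assms(2), of "two_point i i 0"] assms by (simp add: qform_two_point)

lemma psd_on_hermitian:
  assumes "finite S" "psd_on S f" "i \<in> S" "j \<in> S"
  shows "f j i = cnj (f i j)"
proof -
  have "0 \<le> f i i + w * f i j + cnj w * f j i + w * cnj w * f j j" for w
    using psd_onD[OF assms(2), of "two_point i j w"] assms by (simp add: qform_two_point)
  \<comment> \<open>The diagonal is real. Vanishing of the imaginary part at \<open>w = 1\<close>
    makes the imaginary parts of \<open>f i j\<close> and \<open>f j i\<close> opposite; at
    \<open>w = \<i>\<close> it makes their real parts equal.\<close>
  from this[of 1] this[of \<i>] psd_on_diag[OF assms(1-3)] psd_on_diag[OF assms(1,2,4)]
  show ?thesis by (simp add: less_eq_complex_def complex_eq_iff)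
qed

text \<open>With \<open>f s s = 0\<close> the form has no quadratic term in \<open>w\<close>, so a
  nonzero \<open>f k s\<close> would make it unbounded below. The choice of \<open>t\<close> brings
  it to exactly -1.\<close>

lemma psd_on_zero_diag:
  assumes "finite S" "psd_on S f" "k \<in> S" "s \<in> S" "f s s = 0"
  shows "f k s = 0"
proof (rule ccontr)
  assume nz: "f k s \<noteq> 0"
  define t where "t = (Re (f k k) + 1) / (2 * (cmod (f k s))\<^sup>2)"
  define w where "w = - of_real t * cnj (f k s)"
  have "0 \<le> Re (f k k + w * f k s + cnj w * cnj (f k s))"
    using psd_onD[OF assms(2), of "two_point k s w"] assms psd_on_hermitian[OF assms(1-4)]
    by (simp add: qform_two_point less_eq_complex_def)
  also have "\<dots> = Re (f k k) - 2 * t * (cmod (f k s))\<^sup>2"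
    by (simp add: w_def cmod_power2 power2_eq_square[of "Re _"] power2_eq_square[of "Im _"]
        algebra_simps)
  also have "\<dots> = -1"
    using nz by (simp add: t_def field_simps)
  finally show False by simp
qed

section \<open>Gram factorization through Schur complements\<close>

text \<open>If \<open>f s s = 0\<close>, the division by zero yields \<open>f\<close> itself, which is the correct complement.\<close>

lemma psd_on_schur_complement:
  assumes "finite S" "s \<notin> S" and psd: "psd_on (insert s S) f"
  shows "psd_on S (\<lambda>k l. f k l - f k s * f s l / f s s)"
  unfolding psd_on_def
proof
  fix v
  define L where "L = (\<Sum>l\<in>S. f s l * v l)"
  \<comment> \<open>This value at \<open>s\<close> completes the square: the form of
    \<open>f\<close> at \<open>u\<close> is the form of the complement at \<open>v\<close>.\<close>
  define u where "u = v(s := - L / f s s)"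
  have fin: "finite (insert s S)" using assms by simp
  have d: "cnj (f s s) = f s s"
    using psd_on_hermitian[OF fin psd, of s s] by simp
  have cL: "(\<Sum>k\<in>S. cnj (v k) * f k s) = cnj L"
    using psd_on_hermitian[OF fin psd, of s] by (simp add: L_def mult.commute)
  have u: "u k = v k" if "k \<in> S" for k
    using that assms by (auto simp: u_def)
  have us: "u s = - L / f s s" by (simp add: u_def)
  have 1: "(\<Sum>l\<in>S. cnj (u s) * f s l * u l) = cnj (u s) * L"
    by (simp add: L_def sum_distrib_left u mult.assoc)
  have 2: "(\<Sum>k\<in>S. cnj (u k) * f k s * u s) = cnj L * u s"
    by (simp add: cL[symmetric] sum_distrib_right u)
  have 3: "(\<Sum>k\<in>S. \<Sum>l\<in>S. cnj (u k) * f k l * u l) = qform S f v"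
    by (simp add: qform_def u)
  have A: "qform (insert s S) f u
      = cnj (u s) * f s s * u s + cnj (u s) * L + cnj L * u s + qform S f v"
    unfolding qform_def[of "insert s S"] using assms
    by (simp add: sum.distrib 1 2 3)
  have "qform S (\<lambda>k l. f k l - f k s * f s l / f s s) v
      = qform S f v - (\<Sum>k\<in>S. \<Sum>l\<in>S. (cnj (v k) * f k s) * (f s l * v l)) / f s s"
    unfolding qform_def
    by (simp add: sum_subtractf[symmetric] sum_divide_distrib algebra_simps)
  also have "\<dots> = qform S f v - cnj L * L / f s s"
    by (simp add: sum_product[symmetric] cL L_def[symmetric])
  also have "\<dots> = qform (insert s S) f u"
    unfolding A us by (cases "f s s = 0") (simp_all add: d field_simps)
  also have "0 \<le> \<dots>" by (rule psd_onD[OF psd])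
  finally show "0 \<le> qform S (\<lambda>k l. f k l - f k s * f s l / f s s) v" .
qed

text \<open>Each induction step splits off one rank-one term, the column of \<open>s\<close> divided
  by \<open>sqrt (f s s)\<close>, and factors the Schur complement that remains.
  \<open>psd_on_steered\<close> uses this to reduce an effect to rank-one terms.\<close>

lemma psd_on_gram:
  assumes "finite S" "psd_on S f"
  obtains m :: nat and g where "\<And>k l. k \<in> S \<Longrightarrow> l \<in> S \<Longrightarrow> f k l = (\<Sum>r<m. g r k * cnj (g r l))"
proof -
  have "\<exists>(m::nat) g. \<forall>k\<in>S. \<forall>l\<in>S. f k l = (\<Sum>r<m. g r k * cnj (g r l))"
    using assms
  proof (induction S arbitrary: f rule: finite_induct)
    case empty
    then show ?case by simp
  next
    case (insert s S)
    from insert.IH[OF psd_on_schur_complement[OF insert.hyps insert.prems]]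
    obtain m :: nat and g where g: "\<And>k l. k \<in> S \<Longrightarrow> l \<in> S \<Longrightarrow>
        f k l - f k s * f s l / f s s = (\<Sum>r<m. g r k * cnj (g r l))"
      by blast
    have fin: "finite (insert s S)" using insert.hyps by simp
    note herm = psd_on_hermitian[OF fin insert.prems]
    define d where "d = complex_of_real (sqrt (Re (f s s)))"
    have "0 \<le> f s s" by (rule psd_on_diag[OF fin insert.prems]) simp
    then have d: "d * d = f s s"
      unfolding d_def of_real_mult[symmetric]
      by (simp add: less_eq_complex_def complex_eq_iff)
    have cd: "cnj d = d" by (simp add: d_def)
    \<comment> \<open>The old vectors are extended by 0 at \<open>s\<close>; the new one has index
      \<open>m\<close>. If \<open>d = 0\<close>, division by zero makes the new vector 0.\<close>
    define h where "h r k = (if r < m then if k = s then 0 else g r k else f k s / d)" for r k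
    have "f k l = (\<Sum>r<Suc m. h r k * cnj (h r l))" if k: "k \<in> insert s S" and l: "l \<in> insert s S" for k l
    proof -
      have last: "h m k * cnj (h m l) = f k s * f s l / f s s"
        using herm[OF l, of s] d cd by (simp add: h_def)
      show ?thesis
      proof (cases "k = s \<or> l = s")
        case True
        have "(\<Sum>r<m. h r k * cnj (h r l)) = 0"
          using True by (intro sum.neutral) (auto simp: h_def)
        moreover have "f k s * f s l / f s s = f k l"
        proof (cases "f s s = 0")
          \<comment> \<open>A zero diagonal entry forces its whole row and column to vanish, so both
            sides are 0.\<close>
          case z: True
          have "f k s = 0" "f l s = 0"
            using psd_on_zero_diag[OF fin insert.prems _ _ z] k l by blast+
          with True herm[OF l, of s] z show ?thesis by auto
        qed (use True in auto)
        ultimately show ?thesis using last by simp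
      next
        case False
        then have "(\<Sum>r<m. h r k * cnj (h r l)) = f k l - f k s * f s l / f s s"
          using k l by (subst g) (auto simp: h_def)
        with last show ?thesis by simp
      qed
    qed
    then show ?case by blast
  qed
  then show ?thesis using that by blast
qed

section \<open>Bell functionals on product families\<close>

text \<open>Complex values are allowed because the trace is split into products of matrix entries,
  which need not be real.\<close>

definition cpairing ::
    "nat \<Rightarrow> nat \<Rightarrow> (nat \<Rightarrow> nat \<Rightarrow> nat \<Rightarrow> nat \<Rightarrow> real) \<Rightarrow> (nat \<Rightarrow> nat \<Rightarrow> nat \<Rightarrow> nat \<Rightarrow> complex) \<Rightarrow> complex" where
  "cpairing N K M Q =
     (\<Sum>x=1..N. \<Sum>y=1..N. \<Sum>a=1..K. \<Sum>b=1..K. of_real (M x y a b) * Q a b x y)"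

lemma cpairing_of_real: "cpairing N K M (\<lambda>a b x y. of_real (P a b x y)) = of_real (bell_pairing N K M P)"
  by (simp add: cpairing_def bell_pairing_def)

lemma cpairing_cong:
  assumes "\<And>a b x y. x \<in> {1..N} \<Longrightarrow> y \<in> {1..N} \<Longrightarrow> a \<in> {1..K} \<Longrightarrow> b \<in> {1..K} \<Longrightarrow>
    Q a b x y = Q' a b x y"
  shows "cpairing N K M Q = cpairing N K M Q'"
  unfolding cpairing_def by (intro sum.cong refl) (simp add: assms)

lemma cpairing_diff:
  "cpairing N K M (\<lambda>a b x y. Q a b x y - Q' a b x y) = cpairing N K M Q - cpairing N K M Q'"
  by (simp add: cpairing_def sum_subtractf right_diff_distrib)

lemma cpairing_divide: "cpairing N K M (\<lambda>a b x y. Q a b x y / c) = cpairing N K M Q / c"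
  by (simp add: cpairing_def sum_divide_distrib)

lemma cpairing_sum:
  "cpairing N K M (\<lambda>a b x y. \<Sum>i\<in>I. Q i a b x y) = (\<Sum>i\<in>I. cpairing N K M (Q i))"
proof (induction I rule: infinite_finite_induct)
  case (insert i I)
  then show ?case by (simp add: cpairing_def sum.distrib distrib_left)
qed (simp_all add: cpairing_def)

text \<open>No shared randomness is involved: a one-point sample space suffices.\<close>

lemma product_family_classical:
  assumes "\<And>x a. x \<in> {1..N} \<Longrightarrow> a \<in> {1..K} \<Longrightarrow> 0 \<le> A x a"
    and "\<And>x. x \<in> {1..N} \<Longrightarrow> (\<Sum>a=1..K. A x a) = 1"
    and "\<And>y b. y \<in> {1..N} \<Longrightarrow> b \<in> {1..K} \<Longrightarrow> 0 \<le> B y b"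
    and "\<And>y. y \<in> {1..N} \<Longrightarrow> (\<Sum>b=1..K. B y b) = 1"
  shows "(\<lambda>a b x y. A x a * B y b) \<in> classical N K"
proof (rule classical_of_any_space)
  let ?\<Omega> = "return (count_space UNIV) ()"
  interpret prob_space ?\<Omega> by (rule prob_space_return) simp
  show "classical_via ?\<Omega> N K (\<lambda>a b x y. A x a * B y b)"
    unfolding classical_via_def random_response_def
    using assms prob_space_axioms prob_space
    by (intro conjI exI[of _ "\<lambda>a x _. A x a"] exI[of _ "\<lambda>b y _. B y b"]) auto
qed

text \<open>Dividing by \<open>s\<close> and \<open>t\<close> turns the factors into probability
  distributions, so the classical bound applies and homogeneity gives back
  \<open>s * t\<close>.\<close>

lemma cpairing_product_bound:
  assumes M: "\<forall>P'\<in>classical N K. \<bar>bell_pairing N K M P'\<bar> \<le> 1"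
    and A: "\<And>x a. x \<in> {1..N} \<Longrightarrow> a \<in> {1..K} \<Longrightarrow> 0 \<le> A x a"
    and As: "\<And>x. x \<in> {1..N} \<Longrightarrow> (\<Sum>a=1..K. A x a) = s"
    and B: "\<And>y b. y \<in> {1..N} \<Longrightarrow> b \<in> {1..K} \<Longrightarrow> 0 \<le> B y b"
    and Bs: "\<And>y. y \<in> {1..N} \<Longrightarrow> (\<Sum>b=1..K. B y b) = t"
  shows "cmod (cpairing N K M (\<lambda>a b x y. A x a * B y b)) \<le> cmod s * cmod t"
\<comment> \<open>For \<open>N = 0\<close> nothing constrains \<open>s\<close> and \<open>t\<close>,
  but the pairing is empty. If \<open>s\<close> or \<open>t\<close> is 0, nonnegative entries with
  sum 0 all vanish.\<close>
proof (cases "N = 0 \<or> s = 0 \<or> t = 0")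
  case True
  have "A x a * B y b = 0"
    if "x \<in> {1..N}" "y \<in> {1..N}" "a \<in> {1..K}" "b \<in> {1..K}" for x y a b
  proof -
    have "s = 0 \<Longrightarrow> A x a = 0"
      using sum_nonneg_0[of "{1..K}" "A x"] A As that by simp
    moreover have "t = 0 \<Longrightarrow> B y b = 0"
      using sum_nonneg_0[of "{1..K}" "B y"] B Bs that by simp
    ultimately show ?thesis using True that by auto
  qed
  then have "cpairing N K M (\<lambda>a b x y. A x a * B y b) = 0"
    unfolding cpairing_def by (intro sum.neutral ballI) simp
  then show ?thesis by simp
next
  case False
  then have N: "1 \<in> {1..N}" and st: "s \<noteq> 0" "t \<noteq> 0" by auto
  have "0 \<le> s" using As[OF N] A[OF N] by (metis sum_nonneg)
  moreover have "0 \<le> t" using Bs[OF N] B[OF N] by (metis sum_nonneg)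
  ultimately have s: "s = of_real (Re s)" "0 < Re s" and t: "t = of_real (Re t)" "0 < Re t"
    using st by (auto simp: less_eq_complex_def complex_eq_iff)
  define P where "P = (\<lambda>a b x y. (Re (A x a) / Re s) * (Re (B y b) / Re t))"
  have "P \<in> classical N K"
    unfolding P_def using A B s t
    by (intro product_family_classical)
       (auto simp: less_eq_complex_def As Bs Re_sum[symmetric] sum_divide_distrib[symmetric]
             simp del: Re_sum One_nat_def)
  with M have P1: "\<bar>bell_pairing N K M P\<bar> \<le> 1" by blast
  \<comment> \<open>Multiplication by \<open>s * t\<close> is written as division by its inverse so
    that \<open>cpairing_divide\<close> applies.\<close>
  have "cpairing N K M (\<lambda>a b x y. A x a * B y b)
      = cpairing N K M (\<lambda>a b x y. of_real (P a b x y) / (1 / (s * t)))"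
  proof (rule cpairing_cong)
    fix a b x y assume *: "x \<in> {1..N}" "y \<in> {1..N}" "a \<in> {1..K}" "b \<in> {1..K}"
    have AB: "A x a = of_real (Re (A x a))" "B y b = of_real (Re (B y b))"
      using A[of x a] B[of y b] * by (auto simp: less_eq_complex_def complex_eq_iff)
    have "of_real (P a b x y) = A x a * B y b / (s * t)"
      unfolding P_def using AB s(1) t(1) by (metis of_real_divide of_real_mult times_divide_times_eq)
    then show "A x a * B y b = of_real (P a b x y) / (1 / (s * t))"
      using st by simp
  qed
  also have "\<dots> = of_real (bell_pairing N K M P) * (s * t)"
    by (simp only: cpairing_divide cpairing_of_real) simp
  also have "cmod \<dots> \<le> 1 * (cmod s * cmod t)"
    unfolding norm_mult using P1 by (intro mult_right_mono) auto
  finally show ?thesis by simp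
qed

section \<open>Families obtained from assemblages\<close>

text \<open>For \<open>cmod w = 1\<close> each form is its diagonal part plus
  \<open>w * f i j + cnj w * f j i\<close>. Averaging the product over the fourth roots of unity
  kills the terms in \<open>w\<close>, \<open>w^2\<close> and their conjugates, leaving the mixed
  products and the product of the diagonal parts.\<close>

lemma two_point_polarization:
  assumes "finite S" "i \<in> S" "j \<in> S"
  shows "f i j * g j i + f j i * g i j =
    (\<Sum>w\<in>{1, \<i>, -1, -\<i>}. qform S f (two_point i j w) * qform S g (two_point i j w)) / 4
    - (f i i + f j j) * (g i i + g j j)"
proof -
  have "(\<Sum>w\<in>{1, \<i>, -1, -\<i>}. qform S f (two_point i j w) * qform S g (two_point i j w))
      = 4 * (f i j * g j i + f j i * g i j + (f i i + f j j) * (g i i + g j j))"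
    using assms by (simp add: qform_two_point complex_eq_iff) (simp add: algebra_simps)
  then show ?thesis by (simp only:) (simp add: add_divide_distrib)
qed

text \<open>The constant is 6 = 4 + 2: the four polarized products contribute 4 after the division
  by 4, the subtracted diagonal product contributes 2.\<close>

lemma cpairing_assemblage_pair_bound:
  assumes M: "\<forall>P'\<in>classical N K. \<bar>bell_pairing N K M P'\<bar> \<le> 1"
    and S: "finite S" "i \<in> S" "j \<in> S"
    and E: "\<And>x a. x \<in> {1..N} \<Longrightarrow> a \<in> {1..K} \<Longrightarrow> psd_on S (E x a)"
    and Es: "\<And>x k l. x \<in> {1..N} \<Longrightarrow> k \<in> S \<Longrightarrow> l \<in> S \<Longrightarrow> (\<Sum>a=1..K. E x a k l) = of_bool (k = l)"
    and G: "\<And>y b. y \<in> {1..N} \<Longrightarrow> b \<in> {1..K} \<Longrightarrow> psd_on S (G y b)"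
    and Gs: "\<And>y k l. y \<in> {1..N} \<Longrightarrow> k \<in> S \<Longrightarrow> l \<in> S \<Longrightarrow> (\<Sum>b=1..K. G y b k l) = \<sigma> k l"
    and \<sigma>: "psd_on S \<sigma>"
  shows "cmod (cpairing N K M (\<lambda>a b x y. E x a i j * G y b j i + E x a j i * G y b i j))
    \<le> 6 * (Re (\<sigma> i i) + Re (\<sigma> j j))"
proof -
  let ?W = "{1, \<i>, -1, -\<i>} :: complex set"
  let ?v = "two_point i j"
  let ?r = "Re (\<sigma> i i) + Re (\<sigma> j j)"
  let ?Q = "\<lambda>w. cpairing N K M (\<lambda>a b x y. qform S (E x a) (?v w) * qform S (G y b) (?v w))"
  let ?D = "cpairing N K M (\<lambda>a b x y. (E x a i i + E x a j j) * (G y b i i + G y b j j))"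
  have \<sigma>0: "0 \<le> \<sigma> i i" "0 \<le> \<sigma> j j"
    using psd_on_diag[OF S(1) \<sigma>] S by auto
  have q: "cmod (?Q w) \<le> 4 * Re (qform S \<sigma> (?v w))" if w: "w \<in> ?W" for w
  proof -
    have "cmod (?Q w) \<le> cmod (qform S (\<lambda>k l. of_bool (k = l)) (?v w)) * cmod (qform S \<sigma> (?v w))"
    proof (rule cpairing_product_bound[OF M])
      fix x assume x: "x \<in> {1..N}"
      show "(\<Sum>a=1..K. qform S (E x a) (?v w)) = qform S (\<lambda>k l. of_bool (k = l)) (?v w)"
        unfolding qform_sum by (rule qform_cong) (rule Es[OF x])
      show "(\<Sum>b=1..K. qform S (G x b) (?v w)) = qform S \<sigma> (?v w)"
        unfolding qform_sum by (rule qform_cong) (rule Gs[OF x])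
    qed (use E G in \<open>auto intro: psd_onD\<close>)
    also have "\<dots> \<le> 4 * cmod (qform S \<sigma> (?v w))"
    proof (rule mult_right_mono)
      \<comment> \<open>The squared norm of the vector is 2 for \<open>i \<noteq> j\<close>; for
        \<open>i = j\<close> it is the squared modulus of \<open>1 + w\<close>, at most 4.\<close>
      show "cmod (qform S (\<lambda>k l. of_bool (k = l)) (?v w)) \<le> 4"
        using w S by (auto simp: qform_two_point)
    qed simp
    also have "cmod (qform S \<sigma> (?v w)) = Re (qform S \<sigma> (?v w))"
      using psd_onD[OF \<sigma>, of "?v w"] by (simp add: cmod_eq_Re less_eq_complex_def)
    finally show ?thesis .
  qed
  \<comment> \<open>The diagonal correction is itself a product of nonnegative families, with sums 2
    and \<open>\<sigma> i i + \<sigma> j j\<close>.\<close>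
  have D: "cmod ?D \<le> 2 * ?r"
  proof -
    have "cmod ?D \<le> cmod 2 * cmod (\<sigma> i i + \<sigma> j j)"
      using S psd_on_diag[OF S(1) E] psd_on_diag[OF S(1) G]
      by (intro cpairing_product_bound[OF M] add_nonneg_nonneg)
         (simp_all add: sum.distrib Es Gs del: One_nat_def)
    also have "cmod (\<sigma> i i + \<sigma> j j) = ?r"
      using \<sigma>0 by (simp add: cmod_eq_Re less_eq_complex_def)
    finally show ?thesis by simp
  qed
  have split: "cpairing N K M (\<lambda>a b x y. E x a i j * G y b j i + E x a j i * G y b i j)
      = (\<Sum>w\<in>?W. ?Q w) / 4 - ?D"
    by (subst two_point_polarization[OF S]) (simp only: cpairing_diff cpairing_divide cpairing_sum)
  have "cmod ((\<Sum>w\<in>?W. ?Q w) / 4 - ?D) \<le> (\<Sum>w\<in>?W. cmod (?Q w)) / 4 + cmod ?D"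
    by (rule order_trans[OF norm_triangle_ineq4]) (simp add: norm_divide norm_sum del: sum.insert)
  also have "\<dots> \<le> (\<Sum>w\<in>?W. 4 * Re (qform S \<sigma> (?v w))) / 4 + 2 * ?r"
    by (rule add_mono[OF divide_right_mono[OF sum_mono[OF q]] D]) simp_all
  also have "\<dots> = 6 * ?r"
  proof -
    \<comment> \<open>The off-diagonal entries of \<open>\<sigma>\<close> cancel over the four
      roots.\<close>
    have "(\<Sum>w\<in>?W. qform S \<sigma> (?v w)) = 4 * (\<sigma> i i + \<sigma> j j)"
      using S by (simp add: qform_two_point complex_eq_iff)
    then have "(\<Sum>w\<in>?W. Re (qform S \<sigma> (?v w))) = 4 * ?r"
      unfolding Re_sum[symmetric] by simp
    then show ?thesis
      unfolding sum_distrib_left[symmetric] by simp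
  qed
  finally show ?thesis unfolding split .
qed

lemma cpairing_assemblage_bound:
  assumes M: "\<forall>P'\<in>classical N K. \<bar>bell_pairing N K M P'\<bar> \<le> 1"
    and S: "finite S"
    and E: "\<And>x a. x \<in> {1..N} \<Longrightarrow> a \<in> {1..K} \<Longrightarrow> psd_on S (E x a)"
    and Es: "\<And>x k l. x \<in> {1..N} \<Longrightarrow> k \<in> S \<Longrightarrow> l \<in> S \<Longrightarrow> (\<Sum>a=1..K. E x a k l) = of_bool (k = l)"
    and G: "\<And>y b. y \<in> {1..N} \<Longrightarrow> b \<in> {1..K} \<Longrightarrow> psd_on S (G y b)"
    and Gs: "\<And>y k l. y \<in> {1..N} \<Longrightarrow> k \<in> S \<Longrightarrow> l \<in> S \<Longrightarrow> (\<Sum>b=1..K. G y b k l) = \<sigma> k l"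
    and \<sigma>: "(\<Sum>i\<in>S. \<sigma> i i) = 1"
  shows "cmod (cpairing N K M (\<lambda>a b x y. \<Sum>i\<in>S. \<Sum>j\<in>S. E x a i j * G y b j i)) \<le> 6 * real (card S)"
proof (cases "N = 0")
  case True
  then show ?thesis by (simp add: cpairing_def)
next
  case False
  then have N: "1 \<in> {1..N}" by simp
  have psd: "psd_on S \<sigma>"
    unfolding psd_on_def
  proof
    fix v
    have "0 \<le> (\<Sum>b=1..K. qform S (G 1 b) v)"
      by (intro sum_nonneg psd_onD G N)
    also have "\<dots> = qform S \<sigma> v"
      unfolding qform_sum by (rule qform_cong) (rule Gs[OF N])
    finally show "0 \<le> qform S \<sigma> v" .
  qed
  let ?T = "\<lambda>i j. cpairing N K M (\<lambda>a b x y. E x a i j * G y b j i + E x a j i * G y b i j)"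
  \<comment> \<open>Each term is paired with its transpose, since polarization only controls the
    symmetrized product.\<close>
  have sym: "(\<Sum>i\<in>S. \<Sum>j\<in>S. E x a i j * G y b j i)
      = (\<Sum>i\<in>S. \<Sum>j\<in>S. E x a i j * G y b j i + E x a j i * G y b i j) / 2" for a b x y
    using sum.swap[of "\<lambda>i j. E x a i j * G y b j i" S S] by (simp add: sum.distrib)
  have "cpairing N K M (\<lambda>a b x y. \<Sum>i\<in>S. \<Sum>j\<in>S. E x a i j * G y b j i)
      = (\<Sum>i\<in>S. \<Sum>j\<in>S. ?T i j) / 2"
    unfolding sym cpairing_divide cpairing_sum ..
  also have "cmod \<dots> \<le> (\<Sum>i\<in>S. \<Sum>j\<in>S. cmod (?T i j)) / 2"
    by (auto simp: norm_divide intro!: sum_norm_le norm_sum)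
  also have "\<dots> \<le> (\<Sum>i\<in>S. \<Sum>j\<in>S. 6 * (Re (\<sigma> i i) + Re (\<sigma> j j))) / 2"
    by (intro divide_right_mono sum_mono cpairing_assemblage_pair_bound[OF M S _ _ E Es G Gs psd]) auto
  also have "\<dots> = 6 * real (card S) * Re (\<Sum>i\<in>S. \<sigma> i i)"
    by (simp add: sum.distrib sum_distrib_left[symmetric] distrib_left)
  finally show ?thesis by (simp add: \<sigma>)
qed

section \<open>Quantum families as assemblages\<close>

text \<open>\<open>psd\<close> bounds only the real part; the form is real because the matrix is
  Hermitian.\<close>

lemma psd_imp_psd_on:
  assumes "psd n A"
  shows "psd_on {..<n} (\<lambda>i j. A $$ (i, j))"
  unfolding psd_on_def
proof
  fix v
  have A: "A \<in> carrier_mat n n" and adj: "mat_adjoint A = A"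
    and pos: "\<And>v. v \<in> carrier_vec n \<Longrightarrow> 0 \<le> Re ((A *\<^sub>v v) \<bullet>c v)"
    using assms by (auto simp: psd_def)
  have herm: "A $$ (j, i) = cnj (A $$ (i, j))" if "i < n" "j < n" for i j
  proof -
    have "A $$ (j, i) = mat_adjoint A $$ (j, i)" by (simp add: adj)
    also have "\<dots> = cnj (A $$ (i, j))"
      using A that by (simp add: mat_adjoint_def mat_of_rows_def)
    finally show ?thesis .
  qed
  have "(A *\<^sub>v vec n v) \<bullet>c vec n v = qform {..<n} (\<lambda>i j. A $$ (i, j)) v"
    using A by (simp add: scalar_prod_def qform_def sum_distrib_left sum_distrib_right
        lessThan_atLeast0 algebra_simps)
  then have "0 \<le> Re (qform {..<n} (\<lambda>i j. A $$ (i, j)) v)"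
    using pos[of "vec n v"] by simp
  moreover have "cnj (qform {..<n} (\<lambda>i j. A $$ (i, j)) v) = qform {..<n} (\<lambda>i j. A $$ (i, j)) v"
    unfolding qform_def cnj_sum
    by (subst sum.swap) (intro sum.cong refl, simp add: herm[symmetric])
  ultimately show "0 \<le> qform {..<n} (\<lambda>i j. A $$ (i, j)) v"
    by (simp add: less_eq_complex_def complex_eq_iff)
qed

lemma index_finsum_mat:
  assumes "finite I" "\<And>a. a \<in> I \<Longrightarrow> E a \<in> carrier_mat n m" "i < n" "j < m"
  shows "finsum (module_mat TYPE(complex) n m) E I $$ (i, j) = (\<Sum>a\<in>I. E a $$ (i, j))"
proof -
  interpret abelian_group "module_mat TYPE(complex) n m" by (rule abelian_group_mat)
  \<comment> \<open>Carrier membership joins the induction because reading an entry of a matrix sum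
    needs the dimensions of the summands.\<close>
  have "finsum (module_mat TYPE(complex) n m) E I \<in> carrier_mat n m \<and> ?thesis"
    using assms(1,2)
  proof (induction I rule: finite_induct)
    case empty
    then show ?case using assms by (simp add: module_mat_simps)
  next
    case (insert a I)
    then show ?case using assms
      by (subst (1 2) finsum_insert) (auto simp: module_mat_simps)
  qed
  then show ?thesis ..
qed

lemma povm_index_sum:
  assumes "povm n K E" "i < n" "j < n"
  shows "(\<Sum>a=1..K. E a $$ (i, j)) = of_bool (i = j)"
proof -
  have "(\<Sum>a=1..K. E a $$ (i, j)) = finsum (module_mat TYPE(complex) n n) E {1..K} $$ (i, j)"
    using assms by (intro index_finsum_mat[symmetric]) (auto simp: povm_def psd_def)
  also have "\<dots> = of_bool (i = j)"
    using assms by (simp add: povm_def)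
  finally show ?thesis .
qed

section \<open>Steering and the partial trace\<close>

text \<open>
  The partial trace \<open>tr\<^sub>2 ((1 \<otimes> F) \<rho>)\<close>; the basis vector \<open>e\<^sub>i \<otimes> e\<^sub>k\<close> has index \<open>k + i * n\<close>.
\<close>

definition steered :: "nat \<Rightarrow> complex mat \<Rightarrow> complex mat \<Rightarrow> nat \<Rightarrow> nat \<Rightarrow> complex" where
  "steered n \<rho> F j i = (\<Sum>k<n. \<Sum>l<n. F $$ (k, l) * \<rho> $$ (l + j * n, k + i * n))"

lemma mat_trace_kronecker_mult:
  assumes "E \<in> carrier_mat m m" "F \<in> carrier_mat n n" "\<rho> \<in> carrier_mat (m * n) (m * n)"
  shows "mat_trace (kronecker E F * \<rho>) = (\<Sum>i<m. \<Sum>j<m. E $$ (i, j) * steered n \<rho> F j i)"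
proof -
  have bound: "k + i * n < m * n" if "i < m" "k < n" for i k
  proof -
    have "k + i * n < n + i * n" using that by simp
    also have "\<dots> = Suc i * n" by simp
    also have "\<dots> \<le> m * n" using that by (intro mult_right_mono) auto
    finally show ?thesis .
  qed
  have "mat_trace (kronecker E F * \<rho>)
      = (\<Sum>u<m * n. \<Sum>v<m * n. kronecker E F $$ (u, v) * \<rho> $$ (v, u))"
    using assms by (simp add: mat_trace_def kronecker_def scalar_prod_def lessThan_atLeast0)
  also have "\<dots> = (\<Sum>i<m. \<Sum>k<n. \<Sum>j<m. \<Sum>l<n.
      E $$ (i, j) * (F $$ (k, l) * \<rho> $$ (l + j * n, k + i * n)))"
    \<comment> \<open>Each index below \<open>m * n\<close> splits into its two tensor
      coordinates.\<close>
    unfolding sum_mult_product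
    by (intro sum.cong refl) (use assms bound in \<open>simp add: kronecker_def\<close>)
  also have "\<dots> = (\<Sum>i<m. \<Sum>j<m. E $$ (i, j) * steered n \<rho> F j i)"
    unfolding steered_def sum_distrib_left by (intro sum.cong refl sum.swap)
  finally show ?thesis .
qed

text \<open>If \<open>F\<close> is the sum of the rank-one matrices \<open>g r\<close> times its
  adjoint, the form at \<open>v\<close> is the sum over \<open>r\<close> of the forms of
  \<open>\<rho>\<close> at the tensor products \<open>u r\<close> of \<open>v\<close> and
  \<open>g r\<close>.\<close>

lemma psd_on_steered:
  assumes "psd n F" "psd (m * n) \<rho>"
  shows "psd_on {..<m} (steered n \<rho> F)"
  unfolding psd_on_def
proof
  fix v
  obtain R :: nat and g where g: "\<And>k l. k \<in> {..<n} \<Longrightarrow> l \<in> {..<n} \<Longrightarrow>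
      F $$ (k, l) = (\<Sum>r<R. g r k * cnj (g r l))"
    by (rule psd_on_gram[OF finite_lessThan psd_imp_psd_on[OF assms(1)]], rule that)
  define u where "u r c = v (c div n) * g r (c mod n)" for r c
  have five_fold: "(\<Sum>a\<in>A. \<Sum>b\<in>B. \<Sum>c\<in>C. \<Sum>d\<in>D. \<Sum>e\<in>E. h a b c d e)
      = (\<Sum>(a, b, c, d, e)\<in>A \<times> B \<times> C \<times> D \<times> E. h a b c d e)"
    for A :: "nat set" and B :: "nat set" and C :: "nat set" and D :: "nat set" and E :: "nat set"
      and h :: "nat \<Rightarrow> nat \<Rightarrow> nat \<Rightarrow> nat \<Rightarrow> nat \<Rightarrow> complex"
    by (simp only: sum.cartesian_product[symmetric])
  have "qform {..<m} (steered n \<rho> F) v = (\<Sum>j<m. \<Sum>i<m. \<Sum>k<n. \<Sum>l<n. \<Sum>r<R.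
      cnj (u r (l + j * n)) * \<rho> $$ (l + j * n, k + i * n) * u r (k + i * n))"
    unfolding qform_def steered_def sum_distrib_left sum_distrib_right
  proof (intro sum.cong refl, goal_cases)
    case (1 j i k l)
    then show ?case
      by (simp add: g sum_distrib_left sum_distrib_right) (simp add: u_def mult_ac)
  qed
  also have "\<dots> = (\<Sum>r<R. qform {..<m * n} (\<lambda>c d. \<rho> $$ (c, d)) (u r))"
    unfolding qform_def sum_mult_product five_fold
    \<comment> \<open>The permutation groups \<open>(j, l)\<close> as the row index of
      \<open>\<rho>\<close> and \<open>(i, k)\<close> as its column index.\<close>
    by (rule sum.reindex_bij_witness[of _ "\<lambda>(r, j, l, i, k). (j, i, k, l, r)"
          "\<lambda>(j, i, k, l, r). (r, j, l, i, k)"]) auto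
  also have "0 \<le> \<dots>"
    by (intro sum_nonneg psd_onD psd_imp_psd_on assms)
  finally show "0 \<le> qform {..<m} (steered n \<rho> F) v" .
qed

text \<open>This is no-signalling: the effects sum to the identity, so the first site is left with
  the reduced state whatever the second site measures.\<close>

lemma sum_steered_povm:
  assumes "povm n K F"
  shows "(\<Sum>b=1..K. steered n \<rho> (F b) j i) = (\<Sum>k<n. \<rho> $$ (k + j * n, k + i * n))"
proof -
  have "(\<Sum>b=1..K. steered n \<rho> (F b) j i)
      = (\<Sum>k<n. \<Sum>l<n. (\<Sum>b=1..K. F b $$ (k, l)) * \<rho> $$ (l + j * n, k + i * n))"
    unfolding steered_def sum_distrib_right
    by (subst sum.swap, rule sum.cong[OF refl], subst sum.swap) simp
  also have "\<dots> = (\<Sum>k<n. \<Sum>l<n. of_bool (k = l) * \<rho> $$ (l + j * n, k + i * n))"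
    using povm_index_sum[OF assms] by (intro sum.cong refl) simp
  also have "\<dots> = (\<Sum>k<n. \<rho> $$ (k + j * n, k + i * n))"
    by (simp add: of_bool_def if_distrib[of "\<lambda>c. c * _"] cong: if_cong)
  finally show ?thesis .
qed

theorem proposition2:
  shows "\<exists>C::real. C > 0 \<and>
    (\<forall>n N K :: nat. \<forall>P \<in> quantum n n N K. nu N K P \<le> ereal (C * real n))"
proof (intro exI[of _ 6] conjI allI ballI)
  fix n N K :: nat and P
  assume "P \<in> quantum n n N K"
  then obtain \<rho> E F where \<rho>: "density_operator (n * n) \<rho>"
    and E: "\<And>x. x \<in> {1..N} \<Longrightarrow> povm n K (E x)" and F: "\<And>y. y \<in> {1..N} \<Longrightarrow> povm n K (F y)"
    and P: "\<And>x y a b. x \<in> {1..N} \<Longrightarrow> y \<in> {1..N} \<Longrightarrow> a \<in> {1..K} \<Longrightarrow> b \<in> {1..K} \<Longrightarrow>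
      complex_of_real (P a b x y) = mat_trace (kronecker (E x a) (F y b) * \<rho>)"
    unfolding quantum_def by blast
  have psdE: "psd n (E x a)" and psdF: "psd n (F x a)" if "x \<in> {1..N}" "a \<in> {1..K}" for x a
    using E F that by (auto simp: povm_def)
  have psd\<rho>: "psd (n * n) \<rho>" and tr: "mat_trace \<rho> = 1"
    using \<rho> by (auto simp: density_operator_def)
  then have car: "\<rho> \<in> carrier_mat (n * n) (n * n)" by (simp add: psd_def)
  show "nu N K P \<le> ereal (6 * real n)"
    unfolding nu_def
  proof (rule SUP_least)
    fix M assume "M \<in> {M. \<forall>P'\<in>classical N K. \<bar>bell_pairing N K M P'\<bar> \<le> 1}"
    then have M: "\<forall>P'\<in>classical N K. \<bar>bell_pairing N K M P'\<bar> \<le> 1" by simp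
    have "complex_of_real (bell_pairing N K M P) = cpairing N K M
        (\<lambda>a b x y. \<Sum>i<n. \<Sum>j<n. E x a $$ (i, j) * steered n \<rho> (F y b) j i)"
      unfolding cpairing_of_real[symmetric] using psdE psdF car
      by (intro cpairing_cong) (simp add: P psd_def mat_trace_kronecker_mult[of _ n _ n])
    also have "cmod \<dots> \<le> 6 * real (card {..<n})"
    \<comment> \<open>Here \<open>\<sigma>\<close> is the reduced state of the first site; its trace
      is that of \<open>\<rho>\<close>, hence 1.\<close>
    proof (rule cpairing_assemblage_bound[OF M,
          where \<sigma> = "\<lambda>j i. \<Sum>k<n. \<rho> $$ (k + j * n, k + i * n)"])
      show "(\<Sum>i<n. \<Sum>k<n. \<rho> $$ (k + i * n, k + i * n)) = 1"
        using tr car by (simp add: mat_trace_def sum_mult_product)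
      fix x k l assume "x \<in> {1..N}" "k \<in> {..<n}" "l \<in> {..<n}"
      then show "(\<Sum>a=1..K. E x a $$ (k, l)) = of_bool (k = l)"
        by (intro povm_index_sum[OF E]) auto
    qed (simp_all only: finite_lessThan sum_steered_povm[OF F] psd_imp_psd_on[OF psdE] psd_on_steered[OF psdF psd\<rho>])
    finally show "ereal (bell_pairing N K M P) \<le> ereal (6 * real n)"
      by simp
  qed
qed simp

end
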